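(* Let $\Gamma$ be a finite connected simple $k$-regular graph of diameter at least $2$ with $v\ge 4$ vertices, where $2\le k\le v-2$, and with parameters $\lambda=\lambda(\Gamma)$, $\mu=\mu(\Gamma)$ satisfying $0\le\lambda\le k-2$ and $1\le\mu\le k$. Then: (i) if $\mu=1$, then $N_2(\Gamma,2)\ge k+1$; (ii) if $\mu=2$ and $N(\Gamma,1)=2$, then $N_2(\Gamma,2)\ge 2k$; (iii) if $\mu=3$ and $N(\Gamma,1)=3$, then $N_2(\Gamma,2)\ge 3k-5$.
   Context: Let $\Gamma=(V,E)$ be a finite connected simple graph with path distance $d$, and let $B_r(x)=\{y\in V: d(x,y)\le r\}$. Define - $\lambda(\Gamma)$: the maximum, over adjacent pairs $x,y$, of the number of common neighbors of $x$ and $y$; - $\mu(\Gamma)$: the maximum, over pairs $x,y$ with $d(x,y)=2$, of the number of common neighbors of $x$ and $y$; - $N(\Gamma,r)=\max\{|B_r(x)\cap B_r(y)|: x,y\in V,\ x\neq y\}$; - $N_s(\Gamma,r)=\max\{|B_r(x)\cap B_r(y)|: x,y\in V,\ d(x,y)=s\}$. *)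

theory Defs
  imports "Graph_Theory.Graph_Theory"
begin

text \<open>
  A finite simple graph is a \<^locale>\<open>graph\<close>: a finite, symmetric digraph without loops and
  without parallel arcs. An undirected edge is thus a pair of opposite arcs, and the degree of a
  vertex is its out-degree.
\<close>

text \<open>
  The path distance: \<^const>\<open>wf_digraph.\<mu>\<close> is the infimum of the costs of all walks, and with unit
  weights the cost of a walk is its length. The value is \<open>\<infinity>\<close> if there is no walk.
\<close>

definition gdist :: "('a, 'b) pre_digraph \<Rightarrow> 'a \<Rightarrow> 'a \<Rightarrow> ereal" where
  "gdist G x y = wf_digraph.\<mu> G (\<lambda>_. 1) x y"

definition diam :: "('a, 'b) pre_digraph \<Rightarrow> ereal" where
  "diam G = (SUP (x, y) \<in> verts G \<times> verts G. gdist G x y)"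

definition gball :: "('a, 'b) pre_digraph \<Rightarrow> nat \<Rightarrow> 'a \<Rightarrow> 'a set" where
  "gball G r x = {y \<in> verts G. gdist G x y \<le> ereal (real r)}"

definition regular :: "('a, 'b) pre_digraph \<Rightarrow> nat \<Rightarrow> bool" where
  "regular G k \<longleftrightarrow> (\<forall>x \<in> verts G. out_degree G x = k)"

definition common_nbrs :: "('a, 'b) pre_digraph \<Rightarrow> 'a \<Rightarrow> 'a \<Rightarrow> 'a set" where
  "common_nbrs G x y = {z \<in> verts G. x \<rightarrow>\<^bsub>G\<^esub> z \<and> y \<rightarrow>\<^bsub>G\<^esub> z}"

text \<open>
  The maxima below are taken over finite sets of natural numbers. They are meaningful only if the
  set is nonempty, which for distance 2 holds in every connected graph of diameter at least 2.
\<close>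

definition lambda_param :: "('a, 'b) pre_digraph \<Rightarrow> nat" where
  "lambda_param G =
     Max {card (common_nbrs G x y) | x y. x \<in> verts G \<and> y \<in> verts G \<and> x \<rightarrow>\<^bsub>G\<^esub> y}"

definition mu_param :: "('a, 'b) pre_digraph \<Rightarrow> nat" where
  "mu_param G =
     Max {card (common_nbrs G x y) | x y. x \<in> verts G \<and> y \<in> verts G \<and> gdist G x y = 2}"

definition N :: "('a, 'b) pre_digraph \<Rightarrow> nat \<Rightarrow> nat" where
  "N G r =
     Max {card (gball G r x \<inter> gball G r y) | x y. x \<in> verts G \<and> y \<in> verts G \<and> x \<noteq> y}"

definition N_at :: "('a, 'b) pre_digraph \<Rightarrow> nat \<Rightarrow> nat \<Rightarrow> nat" where
  "N_at G s r =
     Max {card (gball G r x \<inter> gball G r y) | x y.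
            x \<in> verts G \<and> y \<in> verts G \<and> gdist G x y = ereal (real s)}"

end

theory Submission
  imports Defs
begin

text \<open>
  Let \<open>x\<close>, \<open>y\<close> be a pair at distance 2 attaining \<open>\<mu>\<close>. The unit balls around all common neighbours
  of \<open>x\<close> and \<open>y\<close> lie in \<open>B\<^sub>2(x) \<inter> B\<^sub>2(y)\<close>. Each has \<open>k + 1\<close> elements, any two of them share at most
  \<open>N(\<Gamma>, 1)\<close> elements, and all of them contain \<open>x\<close> and \<open>y\<close>, so inclusion-exclusion bounds the size
  of their union from below.
\<close>

lemma card_Un_ge:
  assumes "finite A" "finite B" "card (A \<inter> B) \<le> n"
  shows "card A + card B \<le> card (A \<union> B) + n"
  using card_Un_Int[OF assms(1,2)] assms(3) by linarith

text \<open>Inclusion-exclusion for three sets, with only the pairwise intersections estimated. The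
  triple intersection is kept as a term, since its size improves the lower bound for the union. All
  terms are moved so that no subtraction on \<open>nat\<close> occurs.\<close>

lemma card_Un3_ge:
  assumes "finite A" "finite B" "finite C"
    and "card (A \<inter> B) \<le> n" "card (A \<inter> C) \<le> n" "card (B \<inter> C) \<le> n"
  shows "card A + card B + card C + card (A \<inter> B \<inter> C) \<le> card (A \<union> B \<union> C) + 3 * n"
proof -
  have "(A \<union> B) \<inter> C = (A \<inter> C) \<union> (B \<inter> C)" "(A \<inter> C) \<inter> (B \<inter> C) = A \<inter> B \<inter> C" by auto
  then have "card ((A \<union> B) \<inter> C) + card (A \<inter> B \<inter> C) = card (A \<inter> C) + card (B \<inter> C)"
    using card_Un_Int[of "A \<inter> C" "B \<inter> C"] assms by simp
  then show ?thesis
    using card_Un_Int[of "A \<union> B" C] card_Un_Int[of A B] assms by simp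
qed

context wf_digraph
begin

lemma awalk_cost_one: "awalk_cost (\<lambda>_. 1) p = real (length p)"
  by (induction p) auto

text \<open>Walk costs are natural numbers, so the infimum behaves like a minimum here. This turns
  distance bounds into the existence of short walks, which can be concatenated.\<close>

lemma gdist_le_iff: "gdist G x y \<le> ereal (real n) \<longleftrightarrow> (\<exists>p. awalk x p y \<and> length p \<le> n)"
proof
  assume le: "gdist G x y \<le> ereal (real n)"
  \<comment> \<open>Only a strict bound on an infimum yields a walk below it. Integrality of lengths
    then brings \<open>Suc n\<close> back down to \<open>n\<close>.\<close>
  have "gdist G x y < ereal (real (Suc n))"
    by (rule le_less_trans[OF le]) simp
  then obtain p where "awalk x p y" "ereal (awalk_cost (\<lambda>_. 1) p) < ereal (real (Suc n))"
    unfolding gdist_def \<mu>_def INF_less_iff by auto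
  then show "\<exists>p. awalk x p y \<and> length p \<le> n"
    by (auto simp: awalk_cost_one)
next
  assume "\<exists>p. awalk x p y \<and> length p \<le> n"
  then obtain p where p: "awalk x p y" "length p \<le> n" by blast
  have "gdist G x y \<le> ereal (real (length p))"
    using min_cost_le_walk_cost[OF p(1), of "\<lambda>_. 1"] by (simp add: gdist_def awalk_cost_one)
  also have "\<dots> \<le> ereal (real n)" using p(2) by simp
  finally show "gdist G x y \<le> ereal (real n)" .
qed

lemma gdist_triangle:
  assumes "gdist G x y \<le> ereal (real m)" "gdist G y z \<le> ereal (real n)"
  shows "gdist G x z \<le> ereal (real (m + n))"
proof -
  obtain p q where "awalk x p y" "length p \<le> m" "awalk y q z" "length q \<le> n"
    using assms unfolding gdist_le_iff by blast
  then show ?thesis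
    unfolding gdist_le_iff by (intro exI[of _ "p @ q"]) auto
qed

lemma gdist_self: "x \<in> verts G \<Longrightarrow> gdist G x x \<le> ereal (real n)"
  unfolding gdist_le_iff by (intro exI[of _ "[]"]) (simp add: awalk_Nil_iff)

lemma gdist_adj:
  assumes "x \<rightarrow>\<^bsub>G\<^esub> y"
  shows "gdist G x y \<le> ereal (real 1)"
proof -
  obtain e where "e \<in> arcs G" "tail G e = x" "head G e = y"
    using assms by (auto simp: arcs_ends_def arc_to_ends_def)
  then have "awalk x [e] y" using arc_implies_awalk by blast
  then show ?thesis
    unfolding gdist_le_iff by (intro exI[of _ "[e]"]) simp
qed

text \<open>If no walk has length at most \<open>n\<close>, every walk has length at least
  \<open>Suc n\<close>, so \<open>Suc n\<close> bounds the infimum from below.\<close>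

lemma gdist_eq_Suc:
  assumes "gdist G x y \<le> ereal (real (Suc n))" "\<not> gdist G x y \<le> ereal (real n)"
  shows "gdist G x y = ereal (real (Suc n))"
proof (rule antisym[OF assms(1)])
  show "ereal (real (Suc n)) \<le> gdist G x y"
    unfolding gdist_def \<mu>_def
  proof (rule INF_greatest)
    fix p assume "p \<in> {p. awalk x p y}"
    then have "Suc n \<le> length p" using assms(2) unfolding gdist_le_iff by force
    then show "ereal (real (Suc n)) \<le> ereal (awalk_cost (\<lambda>_. 1) p)"
      by (simp add: awalk_cost_one)
  qed
qed

lemma gdist_2_imp_distinct: "gdist G x y = 2 \<Longrightarrow> x \<in> verts G \<Longrightarrow> x \<noteq> y"
  using gdist_self[of x 0] by (auto simp: zero_ereal_def[symmetric])

text \<open>Along a walk from \<open>x\<close> the distance to \<open>x\<close> grows by at most 1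
  per arc. If it can never equal 2, it never exceeds 1, and the diameter would be at most 1.\<close>

lemma exists_gdist_2:
  assumes "strongly_connected G" "diam G \<ge> 2"
  shows "\<exists>x \<in> verts G. \<exists>y \<in> verts G. gdist G x y = 2"
proof (rule ccontr)
  assume none: "\<not> ?thesis"
  have "gdist G x y \<le> ereal (real 1)" if "x \<rightarrow>\<^sup>* y" for x y
    using that
  proof (induction rule: reachable_induct)
    case base
    then show ?case by (rule gdist_self)
  next
    case (step y z)
    have "gdist G x z \<le> ereal (real (Suc 1))"
      using gdist_triangle[OF step.IH gdist_adj[OF step.hyps(2)]] by simp
    moreover have "gdist G x z \<noteq> ereal (real (Suc 1))"
      using none step.hyps reachable_in_verts[of x y] adj_in_verts[of y z] by auto
    ultimately show ?case using gdist_eq_Suc by blast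
  qed
  then have "diam G \<le> ereal (real 1)"
    using assms(1) unfolding diam_def strongly_connected_def by (intro SUP_least) auto
  then have "(2 :: ereal) \<le> ereal (real 1)" using assms(2) by (rule order_trans[rotated])
  then show False by simp
qed

end

context fin_digraph
begin

lemma finite_gball: "finite (gball G r x)"
  by (simp add: gball_def)

lemma finite_image_vertex_pairs: "finite {f x y | x y. x \<in> verts G \<and> y \<in> verts G \<and> P x y}"
proof (rule finite_subset)
  show "{f x y | x y. x \<in> verts G \<and> y \<in> verts G \<and> P x y}
      \<subseteq> case_prod f ` (verts G \<times> verts G)" by auto
qed simp

lemma card_gball_Int_le_N:
  assumes "x \<in> verts G" "y \<in> verts G" "x \<noteq> y"
  shows "card (gball G r x \<inter> gball G r y) \<le> N G r"
  unfolding N_def by (rule Max_ge[OF finite_image_vertex_pairs]) (use assms in auto)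

lemma card_gball_Int_le_N_at:
  assumes "x \<in> verts G" "y \<in> verts G" "gdist G x y = ereal (real s)"
  shows "card (gball G r x \<inter> gball G r y) \<le> N_at G s r"
  unfolding N_at_def by (rule Max_ge[OF finite_image_vertex_pairs]) (use assms in auto)

text \<open>A pair at distance 2 makes the set under \<open>Max\<close> nonempty; being finite as
  well, it contains its maximum.\<close>

lemma mu_param_attained:
  assumes "strongly_connected G" "diam G \<ge> 2"
  obtains x y where "x \<in> verts G" "y \<in> verts G" "gdist G x y = 2"
    "card (common_nbrs G x y) = mu_param G"
proof -
  let ?S = "{card (common_nbrs G x y) | x y. x \<in> verts G \<and> y \<in> verts G \<and> gdist G x y = 2}"
  have "?S \<noteq> {}" using exists_gdist_2[OF assms] by auto
  then have "mu_param G \<in> ?S"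
    unfolding mu_param_def by (rule Max_in[OF finite_image_vertex_pairs])
  then show thesis using that by auto
qed

end

context digraph
begin

text \<open>Without parallel arcs, distinct out-arcs of \<open>x\<close> have distinct heads;
  without loops, none of these heads is \<open>x\<close>. Together with \<open>x\<close> they all
  lie in the unit ball.\<close>

lemma card_gball_1_ge:
  assumes "x \<in> verts G"
  shows "Suc (out_degree G x) \<le> card (gball G 1 x)"
proof -
  have "inj_on (head G) (out_arcs G x)"
    by (rule inj_onI) (auto simp: out_arcs_def arc_to_ends_def intro: no_multi_arcs)
  then have "card (head G ` out_arcs G x) = out_degree G x"
    by (simp add: out_degree_def card_image)
  moreover have "x \<notin> head G ` out_arcs G x"
    using no_loops by (force simp: out_arcs_def)
  ultimately have "card (insert x (head G ` out_arcs G x)) = Suc (out_degree G x)"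
    by (simp add: finite_out_arcs)
  moreover have "insert x (head G ` out_arcs G x) \<subseteq> gball G 1 x"
    using gdist_self[OF assms, of 1] assms gdist_adj[OF in_arcs_imp_in_arcs_ends]
    by (auto simp: gball_def out_arcs_def)
  ultimately show ?thesis
    using card_mono[OF finite_gball] by metis
qed

end

text \<open>The inclusion is the triangle inequality through \<open>z\<close>; the two memberships
  reverse the arcs into \<open>z\<close> by symmetry.\<close>

lemma (in graph) common_nbr_gball:
  assumes "z \<in> common_nbrs G x y"
  shows "gball G 1 z \<subseteq> gball G 2 x \<inter> gball G 2 y" "x \<in> gball G 1 z" "y \<in> gball G 1 z"
proof -
  have adj: "x \<rightarrow>\<^bsub>G\<^esub> z" "y \<rightarrow>\<^bsub>G\<^esub> z" using assms by (auto simp: common_nbrs_def)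
  show "gball G 1 z \<subseteq> gball G 2 x \<inter> gball G 2 y"
    using gdist_triangle[OF gdist_adj[OF adj(1)], of _ 1]
      gdist_triangle[OF gdist_adj[OF adj(2)], of _ 1]
    by (auto simp: gball_def)
  show "x \<in> gball G 1 z" "y \<in> gball G 1 z"
    using adj gdist_adj[of z] graph_symmetric by (auto simp: gball_def)
qed

theorem corollary1:
  fixes G :: "('a, 'b) pre_digraph" and k :: nat
  assumes "graph G" and "connected G" and "regular G k"
    and "diam G \<ge> 2"
    and "card (verts G) \<ge> 4"
    and "2 \<le> k" and "k \<le> card (verts G) - 2"
    and "0 \<le> lambda_param G" and "lambda_param G \<le> k - 2"
    and "1 \<le> mu_param G" and "mu_param G \<le> k"
  shows "(mu_param G = 1 \<longrightarrow> N_at G 2 2 \<ge> k + 1)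
       \<and> (mu_param G = 2 \<and> N G 1 = 2 \<longrightarrow> N_at G 2 2 \<ge> 2 * k)
       \<and> (mu_param G = 3 \<and> N G 1 = 3 \<longrightarrow> int (N_at G 2 2) \<ge> 3 * int k - 5)"
proof -
  interpret graph G by fact
  \<comment> \<open>\<open>connected\<close> refers to the symmetric closure of the digraph; since
    the arcs are already symmetric, directed walks join all vertices.\<close>
  have "strongly_connected G"
    using symmetric_connected_imp_strongly_connected sym_arcs assms(2) by blast
  then obtain x y where xy: "x \<in> verts G" "y \<in> verts G" "gdist G x y = 2"
      and mu: "card (common_nbrs G x y) = mu_param G"
    using mu_param_attained assms(4) by blast
  let ?C = "common_nbrs G x y" and ?B = "gball G 1"
  have C: "z \<in> verts G" if "z \<in> ?C" for z using that by (simp add: common_nbrs_def)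
  have ball: "k + 1 \<le> card (?B z)" if "z \<in> ?C" for z
    using card_gball_1_ge[OF C[OF that]] C[OF that] assms(3) by (simp add: regular_def)
  have int: "card (?B z \<inter> ?B w) \<le> N G 1" if "z \<in> ?C" "w \<in> ?C" "z \<noteq> w" for z w
    using card_gball_Int_le_N C that by blast
  have union: "card (\<Union>z\<in>?C. ?B z) \<le> N_at G 2 2"
  proof -
    have "card (\<Union>z\<in>?C. ?B z) \<le> card (gball G 2 x \<inter> gball G 2 y)"
      using common_nbr_gball(1)[of _ x y] by (intro card_mono finite_Int disjI1 finite_gball) blast
    also have "\<dots> \<le> N_at G 2 2"
      using xy by (intro card_gball_Int_le_N_at) auto
    finally show ?thesis .
  qed
  have "N_at G 2 2 \<ge> k + 1" if 1: "mu_param G = 1"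
  proof -
    obtain z where "?C = {z}" using card_1_singletonE[OF trans[OF mu 1]] by blast
    then show ?thesis using ball[of z] union by simp
  qed
  \<comment> \<open>Two balls of size at least \<open>k + 1\<close> overlap in at most 2 vertices:
    \<open>2 * (k + 1) - 2 = 2 * k\<close>.\<close>
  moreover have "N_at G 2 2 \<ge> 2 * k" if 2: "mu_param G = 2" "N G 1 = 2"
  proof -
    obtain z w where zw: "?C = {z, w}" "z \<noteq> w"
      using mu 2(1) card_2_iff[of ?C] by auto
    then show ?thesis
      using ball[of z] ball[of w] card_Un_ge[OF finite_gball finite_gball int[of z w]] union 2(2)
      by simp
  qed
  moreover have "int (N_at G 2 2) \<ge> 3 * int k - 5" if 3: "mu_param G = 3" "N G 1 = 3"
  proof -
    obtain z w u where zwu: "?C = {z, w, u}" "z \<noteq> w" "z \<noteq> u" "w \<noteq> u"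
      using mu 3(1) card_3_iff[of ?C] by auto
    \<comment> \<open>The vertices \<open>x\<close> and \<open>y\<close> lie in all three balls,
      which adds 2 to the count. The total is \<open>3 * (k + 1) - 3 * 3 + 2 = 3 * k - 4\<close>,
      one more than the bound claimed.\<close>
    have "card {x, y} \<le> card (?B z \<inter> ?B w \<inter> ?B u)"
      using common_nbr_gball(2,3)[of _ x y] zwu(1)
      by (intro card_mono finite_Int disjI2 finite_gball) auto
    then have "2 \<le> card (?B z \<inter> ?B w \<inter> ?B u)"
      using gdist_2_imp_distinct[OF xy(3,1)] by simp
    moreover have "card (?B z) + card (?B w) + card (?B u) + card (?B z \<inter> ?B w \<inter> ?B u)
        \<le> card (?B z \<union> ?B w \<union> ?B u) + 3 * N G 1"
      using zwu by (intro card_Un3_ge finite_gball int) auto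
    moreover have "card (?B z \<union> ?B w \<union> ?B u) \<le> N_at G 2 2"
      using union zwu(1) by (simp add: Un_assoc)
    moreover have "k + 1 \<le> card (?B z)" "k + 1 \<le> card (?B w)" "k + 1 \<le> card (?B u)"
      using ball zwu(1) by auto
    ultimately show ?thesis using 3(2) by linarith
  qed
  ultimately show ?thesis by blast
qed

end
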